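(* Let $N\ge1$, $\gamma>0$, let $\omega_1,\dots,\omega_N$ be independent Gaussian random variables with mean zero and unit variance, and let $P_{\mathsf{sync}}(\gamma,N)$ denote the probability that the Kuramoto system $\frac{d}{dt}\theta_i=\omega_i+\gamma\sum_{j=1}^N\sin(\theta_j-\theta_i)$, $i=1,\dots,N$, has a fully synchronous solution. Then $$P_{\mathsf{sync}}(\gamma,N)\ge\left(\operatorname{erf}\left(\frac{\gamma N}{2\sqrt2}\right)\right)^{N}.$$
   Context: Let $f_i(\theta)=\sum_{j=1}^N\sin(\theta_j-\theta_i)$ for $\theta\in\mathbb{T}^N=(\mathbb{R}/2\pi\mathbb{Z})^N$. Given $\gamma>0$ and $\omega\in\mathbb{R}^N$, pass to the co-rotating frame, i.e. replace $\omega$ by $\tilde\omega_i=\omega_i-\frac1N\sum_k\omega_k$. The system has a fully synchronous solution if there is $\theta\in\mathbb{T}^N$ with $\gamma f(\theta)=-\tilde\omega$ such that the Jacobian matrix $J(\theta)=(\partial f_i/\partial\theta_j)_{i,j}$ is negative semi-definite with a one-dimensional kernel. Here $\operatorname{erf}(x)=\frac{2}{\sqrt\pi}\int_0^xe^{-t^2}\,dt$. *)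

theory Defs
  imports "HOL-Probability.Probability"
begin

text \<open>The interval integral is oriented, so the definition is also the usual one for \<open>x < 0\<close>.\<close>

definition erf :: "real \<Rightarrow> real" where
  "erf x = 2 / sqrt pi * (LBINT t=0..x. exp (- t\<^sup>2))"

text \<open>A point of the torus is represented by a lift \<open>\<theta> :: real ^ 'n\<close>; everything below is
  \<open>2 * pi\<close>-periodic in each coordinate. The number of oscillators is \<open>CARD('n)\<close>.\<close>

definition coupling :: "real ^ 'n \<Rightarrow> real ^ 'n" where
  "coupling \<theta> = (\<chi> i. \<Sum>j\<in>UNIV. sin (\<theta> $ j - \<theta> $ i))"

definition corotating :: "real ^ 'n \<Rightarrow> real ^ 'n" where
  "corotating \<omega> = (\<chi> i. \<omega> $ i - (\<Sum>k\<in>UNIV. \<omega> $ k) / real CARD('n))"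

definition neg_semidefinite :: "real ^ 'n ^ 'n \<Rightarrow> bool" where
  "neg_semidefinite A \<longleftrightarrow> transpose A = A \<and> (\<forall>x. x \<bullet> (A *v x) \<le> 0)"

definition has_fully_synchronous_solution :: "real \<Rightarrow> real ^ 'n \<Rightarrow> bool" where
  "has_fully_synchronous_solution \<gamma> \<omega> \<longleftrightarrow>
    (\<exists>\<theta>. \<gamma> *\<^sub>R coupling \<theta> = - corotating \<omega> \<and>
      neg_semidefinite (jacobian coupling (at \<theta>)) \<and>
      dim {x. jacobian coupling (at \<theta>) *v x = 0} = 1)"

end

theory Submission
  imports Defs
begin

text \<open>If \<open>\<bar>\<omega>\<^sub>i\<bar> < \<gamma> * N / 2\<close> for all \<open>i\<close>, the natural frequencies differ by less than \<open>\<gamma> * N\<close>. The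
  potential with gradient \<open>\<gamma> f + w\<close>, where \<open>w\<close> is the co-rotating frequency vector, then attains its
  maximum over the configurations with all phase differences at most \<open>pi / 2\<close> at an interior
  point: if \<open>\<theta>\<^sub>i - \<theta>\<^sub>k = pi / 2\<close> at a maximizer, lowering \<open>\<theta>\<^sub>i\<close> and raising \<open>\<theta>\<^sub>k\<close> are both
  admissible, so the gradient satisfies \<open>g\<^sub>i \<ge> 0 \<ge> g\<^sub>k\<close>, while \<open>sin a + cos a \<ge> 1\<close> gives
  \<open>g\<^sub>i - g\<^sub>k \<le> - \<gamma> * N + (w\<^sub>i - w\<^sub>k) < 0\<close>. The interior maximizer is an equilibrium, and its
  Jacobian is minus a graph Laplacian with positive weights \<open>cos (\<theta>\<^sub>j - \<theta>\<^sub>i)\<close>. The event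
  \<open>\<forall>i. \<bar>\<omega>\<^sub>i\<bar> < \<gamma> * N / 2\<close> has the asserted probability by independence.\<close>

section \<open>The Jacobian of the coupling as a weighted Laplacian\<close>

text \<open>The Jacobian is kept as a linear map, so that its diagonal, minus the row sums of the
  cosine weights, is never written out.\<close>

definition cos_laplacian :: "real ^ 'n \<Rightarrow> real ^ 'n \<Rightarrow> real ^ 'n" where
  "cos_laplacian \<theta> x = (\<chi> i. \<Sum>j\<in>UNIV. cos (\<theta> $ j - \<theta> $ i) * (x $ j - x $ i))"

lemma coupling_has_derivative:
  "(coupling has_derivative cos_laplacian \<theta>) (at (\<theta> :: real ^ 'n))"
proof -
  have "((\<lambda>\<theta>. coupling \<theta> \<bullet> b) has_derivative (\<lambda>x. cos_laplacian \<theta> x \<bullet> b)) (at \<theta>)"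
    if b: "b \<in> Basis" for b :: "real ^ 'n"
  proof -
    obtain i where b: "b = axis i 1"
      using b unfolding Basis_vec_def by auto
    show ?thesis
      unfolding b coupling_def cos_laplacian_def inner_axis
      by (auto intro!: derivative_eq_intros bounded_linear_imp_has_derivative bounded_linear_vec_nth
          simp: mult.commute)
  qed
  then show ?thesis
    by (subst has_derivative_componentwise_within) auto
qed

lemma jacobian_coupling: "jacobian coupling (at \<theta>) *v x = cos_laplacian \<theta> x"
proof -
  have "coupling differentiable at \<theta>"
    using coupling_has_derivative differentiable_def by blast
  then have "(coupling has_derivative (\<lambda>h. jacobian coupling (at \<theta>) *v h)) (at \<theta>)"
    by (simp add: jacobian_works)
  from has_derivative_unique[OF this coupling_has_derivative] show ?thesis
    by metis
qed

lemma linear_cos_laplacian: "linear (cos_laplacian \<theta>)"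
  using coupling_has_derivative has_derivative_linear by blast

text \<open>Summation by parts: cosine is even, so the weights are symmetric, and the double sum is
  averaged with its index-swapped copy. The bilinear version yields both the symmetry of the
  Jacobian and its quadratic form.\<close>

lemma inner_cos_laplacian:
  "x \<bullet> cos_laplacian \<theta> y =
    - (\<Sum>i\<in>UNIV. \<Sum>j\<in>UNIV. cos (\<theta> $ j - \<theta> $ i) * (x $ j - x $ i) * (y $ j - y $ i)) / 2"
proof -
  define S where "S = x \<bullet> cos_laplacian \<theta> y"
  have S1: "S = (\<Sum>i\<in>UNIV. \<Sum>j\<in>UNIV. cos (\<theta> $ j - \<theta> $ i) * x $ i * (y $ j - y $ i))"
    by (simp add: S_def inner_vec_def cos_laplacian_def sum_distrib_left mult_ac)
  have S2: "S = (\<Sum>i\<in>UNIV. \<Sum>j\<in>UNIV. cos (\<theta> $ j - \<theta> $ i) * x $ j * (y $ i - y $ j))"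
    unfolding S1 by (subst sum.swap, intro sum.cong refl) (metis cos_minus minus_diff_eq)
  have "S + S = - (\<Sum>i\<in>UNIV. \<Sum>j\<in>UNIV. cos (\<theta> $ j - \<theta> $ i) * (x $ j - x $ i) * (y $ j - y $ i))"
    by (subst (1) S1, subst S2)
      (simp add: sum.distrib[symmetric] sum_negf[symmetric] algebra_simps)
  then show ?thesis
    by (simp add: S_def)
qed

text \<open>Symmetry of the matrix comes from the symmetry of the bilinear form, evaluated at pairs
  of axis vectors; what remains is the sign of the quadratic form.\<close>

lemma neg_semidefinite_jacobian_coupling:
  "neg_semidefinite (jacobian coupling (at \<theta>)) \<longleftrightarrow> (\<forall>x. x \<bullet> cos_laplacian \<theta> x \<le> 0)"
proof -
  define A where "A = jacobian coupling (at \<theta>)"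
  have entry: "A $ i $ j = axis i 1 \<bullet> cos_laplacian \<theta> (axis j 1)" for i j
    by (simp add: A_def jacobian_coupling[symmetric] matrix_vector_mult_basis column_def inner_axis')
  have "x \<bullet> cos_laplacian \<theta> y = y \<bullet> cos_laplacian \<theta> x" for x y
    unfolding inner_cos_laplacian by (simp add: mult_ac)
  then have "transpose A = A"
    by (simp add: vec_eq_iff transpose_def entry)
  then show ?thesis
    by (simp add: neg_semidefinite_def A_def jacobian_coupling)
qed

lemma cos_laplacian_vec [simp]: "cos_laplacian \<theta> (vec c) = 0"
  by (simp add: cos_laplacian_def vec_eq_iff)

text \<open>Constant vectors always lie in the kernel. The kernel is therefore a line exactly when
  it meets the complementary zero-sum hyperplane trivially; subtracting the mean projects onto that
  hyperplane.\<close>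

lemma dim_ker_cos_laplacian:
  fixes \<theta> :: "real ^ 'n"
  shows "dim {x. cos_laplacian \<theta> x = 0} = 1 \<longleftrightarrow>
    (\<forall>x. cos_laplacian \<theta> x = 0 \<and> (\<Sum>i\<in>UNIV. x $ i) = 0 \<longrightarrow> x = 0)"
proof -
  let ?K = "{x. cos_laplacian \<theta> x = 0}"
  have sub: "subspace ?K"
    using linear_cos_laplacian by (rule linear_subspace_kernel)
  have le: "span {1} \<subseteq> ?K"
    using sub cos_laplacian_vec[of \<theta> 1] by (intro span_minimal) (auto simp: vec_eq_iff one_vec_def vec_def)
  have one: "(1 :: real ^ 'n) \<noteq> 0"
    by (simp add: vec_eq_iff)
  have d1: "dim (span {1 :: real ^ 'n}) = 1"
    using one dim_singleton by (simp add: dim_span)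
  show ?thesis
  proof
    assume d: "dim ?K = 1"
    have eq: "span {1} = ?K"
      by (rule subspace_dim_equal[OF _ sub le]) (simp_all add: d d1)
    show "\<forall>x. cos_laplacian \<theta> x = 0 \<and> (\<Sum>i\<in>UNIV. x $ i) = 0 \<longrightarrow> x = 0"
    proof (intro allI impI)
      fix x assume x: "cos_laplacian \<theta> x = 0 \<and> (\<Sum>i\<in>UNIV. x $ i) = 0"
      then have "x \<in> span {1}" using eq by auto
      then obtain k where "x = k *\<^sub>R 1" by (auto simp: span_singleton)
      then show "x = 0" using x by simp
    qed
  next
    assume inj: "\<forall>x. cos_laplacian \<theta> x = 0 \<and> (\<Sum>i\<in>UNIV. x $ i) = 0 \<longrightarrow> x = 0"
    have "?K \<subseteq> span {1}"
    proof
      fix x assume x: "x \<in> ?K"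
      define m where "m = (\<Sum>i\<in>UNIV. x $ i) / real CARD('n)"
      have "m *\<^sub>R 1 \<in> ?K"
        using le span_superset subspace_mul sub by (metis insertI1 subsetD)
      then have "x - m *\<^sub>R 1 \<in> ?K"
        using x sub subspace_diff by blast
      moreover have "(\<Sum>i\<in>UNIV. (x - m *\<^sub>R 1) $ i) = 0"
        by (simp add: sum_subtractf m_def)
      ultimately have "x = m *\<^sub>R 1" using inj by auto
      then show "x \<in> span {1}" by (auto simp: span_singleton)
    qed
    with le have "?K = span {1}" by blast
    then show "dim ?K = 1" using d1 by simp
  qed
qed

lemma has_fully_synchronous_solution_iff:
  "has_fully_synchronous_solution \<gamma> \<omega> \<longleftrightarrow>
    (\<exists>\<theta>. \<gamma> *\<^sub>R coupling \<theta> = - corotating \<omega> \<and>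
      (\<forall>x. x \<bullet> cos_laplacian \<theta> x \<le> 0) \<and>
      (\<forall>x. cos_laplacian \<theta> x = 0 \<and> (\<Sum>i\<in>UNIV. x $ i) = 0 \<longrightarrow> x = 0))"
  unfolding has_fully_synchronous_solution_def neg_semidefinite_jacobian_coupling jacobian_coupling
    dim_ker_cos_laplacian ..

section \<open>Stability and existence of equilibria within a quarter arc\<close>

text \<open>All cosine weights are positive here, so the quadratic form is minus a sum of
  nonnegative terms. It vanishes only if all coordinates of \<open>x\<close> agree, and a constant
  zero-sum vector is 0.\<close>

lemma small_spread_stable:
  fixes \<theta> :: "real ^ 'n"
  assumes spread: "\<And>i j. \<bar>\<theta> $ i - \<theta> $ j\<bar> < pi / 2"
  shows "x \<bullet> cos_laplacian \<theta> x \<le> 0"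
    and "cos_laplacian \<theta> x = 0 \<Longrightarrow> (\<Sum>i\<in>UNIV. x $ i) = 0 \<Longrightarrow> x = 0"
proof -
  have c: "cos (\<theta> $ j - \<theta> $ i) > 0" for i j
    using spread[of j i] unfolding abs_less_iff by (intro cos_gt_zero_pi) linarith+
  have nn: "cos (\<theta> $ j - \<theta> $ i) * (x $ j - x $ i) * (x $ j - x $ i) \<ge> 0" for i j
    using c[of j i] by (simp add: mult.assoc)
  show "x \<bullet> cos_laplacian \<theta> x \<le> 0"
    unfolding inner_cos_laplacian using nn by (simp add: sum_nonneg)
  assume "cos_laplacian \<theta> x = 0" and sum0: "(\<Sum>i\<in>UNIV. x $ i) = 0"
  then have "(\<Sum>i\<in>UNIV. \<Sum>j\<in>UNIV. cos (\<theta> $ j - \<theta> $ i) * (x $ j - x $ i) * (x $ j - x $ i)) = 0"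
    using inner_cos_laplacian[of x \<theta> x] by simp
  then have "cos (\<theta> $ j - \<theta> $ i) * (x $ j - x $ i) * (x $ j - x $ i) = 0" for i j
    using nn by (simp add: sum_nonneg_eq_0_iff sum_nonneg)
  then have eq: "x $ j = x $ i" for i j
    using c[of j i] by (metis less_irrefl mult_eq_0_iff eq_iff_diff_eq_0)
  show "x = 0"
  proof (rule vec_eq_iff[THEN iffD2], rule allI)
    fix i
    have "(\<Sum>j\<in>UNIV. x $ j) = (\<Sum>j\<in>(UNIV :: 'n set). x $ i)"
      by (intro sum.cong refl eq)
    with sum0 show "x $ i = 0 $ i" by simp
  qed
qed

text \<open>The factor 1/2 compensates for counting each pair twice. Because of the linear term this
  is a function of the lift, not of the point on the torus.\<close>

definition kuramoto_potential :: "real \<Rightarrow> real ^ 'n \<Rightarrow> real ^ 'n \<Rightarrow> real" where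
  "kuramoto_potential \<gamma> w \<theta> =
    \<gamma> / 2 * (\<Sum>i\<in>UNIV. \<Sum>j\<in>UNIV. cos (\<theta> $ j - \<theta> $ i)) + (\<Sum>i\<in>UNIV. w $ i * \<theta> $ i)"

text \<open>The step \<open>s\<close> carries the direction: with \<open>s = 1\<close> and
  \<open>s = - 1\<close>, moving to the right in \<open>t\<close> covers both raising and lowering
  the phase \<open>k\<close>.\<close>

lemma kuramoto_potential_partial_derivative:
  "((\<lambda>t. kuramoto_potential \<gamma> w (\<theta> + t *\<^sub>R axis k s)) has_real_derivative
     s * (\<gamma> * coupling \<theta> $ k + w $ k)) (at 0)"
proof -
  define \<delta> where "\<delta> i = axis k s $ i" for i
  have \<delta>: "\<delta> i = (if i = k then s else 0)" for i
    by (simp add: \<delta>_def axis_def)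
  have "((\<lambda>t. kuramoto_potential \<gamma> w (\<theta> + t *\<^sub>R axis k s)) has_real_derivative
     \<gamma> / 2 * (\<Sum>i\<in>UNIV. \<Sum>j\<in>UNIV. - sin (\<theta> $ j - \<theta> $ i) * (\<delta> j - \<delta> i)) + (\<Sum>i\<in>UNIV. w $ i * \<delta> i)) (at 0)"
    unfolding kuramoto_potential_def vector_add_component vector_scaleR_component \<delta>_def[symmetric]
    by (auto intro!: derivative_eq_intros simp: mult.commute)
  moreover have "(\<Sum>i\<in>UNIV. w $ i * \<delta> i) = s * w $ k"
    by (simp add: \<delta> if_distrib cong: if_cong)
  \<comment> \<open>Sine is odd, so the terms with \<open>i = k\<close> and those with
    \<open>j = k\<close> contribute equally; the resulting 2 cancels the 1/2 in the
    potential.\<close>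
  moreover have "(\<Sum>i\<in>UNIV. \<Sum>j\<in>UNIV. - sin (\<theta> $ j - \<theta> $ i) * (\<delta> j - \<delta> i)) = 2 * s * coupling \<theta> $ k"
  proof -
    have 1: "(\<Sum>i\<in>UNIV. \<Sum>j\<in>UNIV. sin (\<theta> $ j - \<theta> $ i) * \<delta> i) = s * coupling \<theta> $ k"
    proof -
      have "(\<Sum>i\<in>UNIV. \<Sum>j\<in>UNIV. sin (\<theta> $ j - \<theta> $ i) * \<delta> i) = (\<Sum>i\<in>UNIV. coupling \<theta> $ i * \<delta> i)"
        by (simp add: coupling_def sum_distrib_right)
      then show ?thesis
        by (simp add: \<delta> if_distrib cong: if_cong)
    qed
    have 2: "(\<Sum>i\<in>UNIV. \<Sum>j\<in>UNIV. sin (\<theta> $ j - \<theta> $ i) * \<delta> j) = - (s * coupling \<theta> $ k)"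
      unfolding 1[symmetric] sum_negf[symmetric]
      by (subst sum.swap, intro sum.cong refl) (metis minus_diff_eq mult_minus_left sin_minus)
    have "(\<Sum>i\<in>UNIV. \<Sum>j\<in>UNIV. - sin (\<theta> $ j - \<theta> $ i) * (\<delta> j - \<delta> i)) =
      (\<Sum>i\<in>UNIV. \<Sum>j\<in>UNIV. sin (\<theta> $ j - \<theta> $ i) * \<delta> i) - (\<Sum>i\<in>UNIV. \<Sum>j\<in>UNIV. sin (\<theta> $ j - \<theta> $ i) * \<delta> j)"
      by (simp add: sum_subtractf[symmetric] algebra_simps)
    then show ?thesis unfolding 1 2 by simp
  qed
  ultimately show ?thesis
    by (simp add: algebra_simps)
qed

text \<open>Phase differences are unchanged by a common shift, and the linear term changes by a
  multiple of the sum of \<open>w\<close>, which is 0.\<close>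

lemma kuramoto_potential_shift:
  assumes "(\<Sum>i\<in>UNIV. w $ i) = 0"
  shows "kuramoto_potential \<gamma> w (\<theta> - vec c) = kuramoto_potential \<gamma> w \<theta>"
proof -
  have "(\<Sum>i\<in>UNIV. w $ i * c) = 0"
    using assms by (simp add: sum_distrib_right[symmetric])
  then show ?thesis
    by (simp add: kuramoto_potential_def right_diff_distrib sum_subtractf)
qed

text \<open>The admissible set is unbounded along the diagonal. Pinning one arbitrary phase to 0
  makes it compact, and shift invariance carries the maximum over to all admissible
  configurations.\<close>

lemma quarter_arc_maximizer:
  fixes w :: "real ^ 'n"
  assumes "(\<Sum>i\<in>UNIV. w $ i) = 0"
  obtains \<theta> where "\<And>i j. \<bar>\<theta> $ i - \<theta> $ j\<bar> \<le> pi / 2"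
    and "\<And>\<phi>. (\<And>i j. \<bar>\<phi> $ i - \<phi> $ j\<bar> \<le> pi / 2) \<Longrightarrow>
      kuramoto_potential \<gamma> w \<phi> \<le> kuramoto_potential \<gamma> w \<theta>"
proof -
  fix a :: 'n
  define K where "K = {\<theta> :: real ^ 'n. (\<forall>i j. \<bar>\<theta> $ i - \<theta> $ j\<bar> \<le> pi / 2) \<and> \<theta> $ a = 0}"
  have "closed K"
    unfolding K_def by (intro closed_Collect_conj closed_Collect_all closed_Collect_le closed_Collect_eq continuous_intros)
  moreover have "K \<subseteq> cbox (vec (- pi / 2)) (vec (pi / 2))"
  proof
    fix \<theta> assume "\<theta> \<in> K"
    then have abs: "\<bar>\<theta> $ i\<bar> \<le> pi / 2" for i
      unfolding K_def by (metis (mono_tags, lifting) diff_zero mem_Collect_eq)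
    have "\<theta> $ i \<le> pi / 2" "- pi / 2 \<le> \<theta> $ i" for i
      using abs_le_D1[OF abs[of i]] abs_le_D2[OF abs[of i]] by linarith+
    then show "\<theta> \<in> cbox (vec (- pi / 2)) (vec (pi / 2))"
      by (simp add: mem_box_cart)
  qed
  ultimately have "compact K"
    by (metis bounded_cbox bounded_subset compact_eq_bounded_closed)
  moreover have "0 \<in> K"
    by (simp add: K_def)
  moreover have "continuous_on K (kuramoto_potential \<gamma> w)"
    unfolding kuramoto_potential_def by (intro continuous_intros)
  ultimately obtain \<theta> where \<theta>: "\<theta> \<in> K"
    and max: "\<And>\<phi>. \<phi> \<in> K \<Longrightarrow> kuramoto_potential \<gamma> w \<phi> \<le> kuramoto_potential \<gamma> w \<theta>"
    by (metis continuous_attains_sup empty_iff)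
  show ?thesis
  proof (rule that)
    show "\<bar>\<theta> $ i - \<theta> $ j\<bar> \<le> pi / 2" for i j
      using \<theta> by (simp add: K_def)
    fix \<phi> :: "real ^ 'n" assume "\<And>i j. \<bar>\<phi> $ i - \<phi> $ j\<bar> \<le> pi / 2"
    then have "\<phi> - vec (\<phi> $ a) \<in> K"
      by (simp add: K_def)
    from max[OF this] show "kuramoto_potential \<gamma> w \<phi> \<le> kuramoto_potential \<gamma> w \<theta>"
      by (simp add: kuramoto_potential_shift[OF assms])
  qed
qed

text \<open>On this range sine and cosine lie between 0 and 1, so they dominate their squares, which
  add up to 1.\<close>

lemma sin_add_sin_ge_1:
  assumes "0 \<le> a" "a \<le> pi / 2"
  shows "1 \<le> sin a + sin (pi / 2 - a)"
proof -
  have s: "0 \<le> sin a" "0 \<le> cos a"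
    using assms by (simp_all add: sin_ge_zero cos_ge_zero)
  have "(sin a)\<^sup>2 \<le> sin a" "(cos a)\<^sup>2 \<le> cos a"
    using s by (simp_all add: power2_eq_square mult_left_le)
  moreover have "(sin a)\<^sup>2 + (cos a)\<^sup>2 = 1"
    by simp
  moreover have "sin (pi / 2 - a) = cos a"
    by (simp add: cos_sin_eq)
  ultimately show ?thesis by linarith
qed

text \<open>Every phase lies between those of \<open>k\<close> and \<open>i\<close>, so each of the
  N summands of the difference is at most -1 by the preceding inequality.\<close>

lemma coupling_diff_extremes:
  fixes \<theta> :: "real ^ 'n"
  assumes "\<And>i j. \<bar>\<theta> $ i - \<theta> $ j\<bar> \<le> pi / 2" and ik: "\<theta> $ i - \<theta> $ k = pi / 2"
  shows "coupling \<theta> $ i - coupling \<theta> $ k \<le> - real CARD('n)"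
proof -
  have "sin (\<theta> $ j - \<theta> $ i) - sin (\<theta> $ j - \<theta> $ k) \<le> - 1" for j
  proof -
    have "1 \<le> sin (\<theta> $ i - \<theta> $ j) + sin (pi / 2 - (\<theta> $ i - \<theta> $ j))"
      using assms(1)[of i j] assms(1)[of j k] ik
      by (intro sin_add_sin_ge_1) (simp_all add: abs_le_iff)
    moreover have "pi / 2 - (\<theta> $ i - \<theta> $ j) = \<theta> $ j - \<theta> $ k"
      using ik by simp
    moreover have "sin (\<theta> $ i - \<theta> $ j) = - sin (\<theta> $ j - \<theta> $ i)"
      by (metis minus_diff_eq sin_minus)
    ultimately show ?thesis by simp
  qed
  then have "(\<Sum>j\<in>UNIV. sin (\<theta> $ j - \<theta> $ i) - sin (\<theta> $ j - \<theta> $ k)) \<le> (\<Sum>j\<in>(UNIV :: 'n set). - 1)"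
    by (intro sum_mono)
  then show ?thesis
    by (simp add: coupling_def sum_subtractf)
qed

lemma equilibrium_in_quarter_arc:
  fixes w :: "real ^ 'n"
  assumes \<gamma>: "\<gamma> > 0" and sum0: "(\<Sum>i\<in>UNIV. w $ i) = 0"
    and spread: "\<And>i k. w $ i - w $ k < \<gamma> * real CARD('n)"
  obtains \<theta> where "\<gamma> *\<^sub>R coupling \<theta> = - w" and "\<And>i j. \<bar>\<theta> $ i - \<theta> $ j\<bar> < pi / 2"
proof -
  obtain \<theta> where le: "\<And>i j. \<bar>\<theta> $ i - \<theta> $ j\<bar> \<le> pi / 2"
    and max: "\<And>\<phi>. (\<And>i j. \<bar>\<phi> $ i - \<phi> $ j\<bar> \<le> pi / 2) \<Longrightarrow>
      kuramoto_potential \<gamma> w \<phi> \<le> kuramoto_potential \<gamma> w \<theta>"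
    using quarter_arc_maximizer[OF sum0, of \<gamma>] by metis
  define g where "g k = \<gamma> * coupling \<theta> $ k + w $ k" for k
  have le': "\<theta> $ i - \<theta> $ j \<le> pi / 2" for i j
    using le by (rule abs_le_D1)
  \<comment> \<open>First-order condition at the maximizer: if phase \<open>k\<close> can move a
    little in direction \<open>s\<close> and stay admissible, the potential cannot have positive
    slope in that direction.\<close>
  have push: "s * g k \<le> 0" if s: "\<bar>s\<bar> = 1" and room: "\<And>j. s * (\<theta> $ k - \<theta> $ j) < pi / 2" for s k
  proof (rule ccontr)
    assume "\<not> s * g k \<le> 0"
    then have "0 < s * (\<gamma> * coupling \<theta> $ k + w $ k)"
      by (simp add: g_def)
    from DERIV_pos_inc_right[OF kuramoto_potential_partial_derivative this]
    obtain d where d: "d > 0"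
      "\<And>t. 0 < t \<Longrightarrow> t < d \<Longrightarrow> kuramoto_potential \<gamma> w \<theta> < kuramoto_potential \<gamma> w (\<theta> + t *\<^sub>R axis k s)"
      by auto
    \<comment> \<open>\<open>R\<close> is the smallest slack over all pairs involving
      \<open>k\<close>. A step of length \<open>R\<close> is still allowed since the constraint is
      not strict, while \<open>d / 2\<close> keeps the step strictly below \<open>d\<close>.\<close>
    define R where "R = Min (range (\<lambda>j. pi / 2 - s * (\<theta> $ k - \<theta> $ j)))"
    have R: "R > 0"
      using room by (simp add: R_def)
    have R_le: "R \<le> pi / 2 - s * (\<theta> $ k - \<theta> $ j)" for j
      unfolding R_def by (rule Min_le) auto
    define t where "t = min (d / 2) R"
    have t: "0 < t" "t < d" "t \<le> R"
      using d(1) R by (auto simp: t_def)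
    have tj: "s * (\<theta> $ k - \<theta> $ j) + t \<le> pi / 2" "- (pi / 2) \<le> s * (\<theta> $ k - \<theta> $ j) + t" for j
    proof -
      show "s * (\<theta> $ k - \<theta> $ j) + t \<le> pi / 2"
        using R_le[of j] t by linarith
      have "\<bar>s * (\<theta> $ k - \<theta> $ j)\<bar> \<le> pi / 2"
        using le[of k j] s by (simp add: abs_mult)
      then show "- (pi / 2) \<le> s * (\<theta> $ k - \<theta> $ j) + t"
        using t(1) by linarith
    qed
    have kj: "\<bar>\<theta> $ k + t * s - \<theta> $ j\<bar> \<le> pi / 2" for j
    proof -
      have "s * s = 1"
        using s by (metis abs_mult_self_eq mult_1)
      then have "s * (\<theta> $ k + t * s - \<theta> $ j) = s * (\<theta> $ k - \<theta> $ j) + t"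
        by (simp add: algebra_simps)
      then have "\<bar>s * (\<theta> $ k + t * s - \<theta> $ j)\<bar> \<le> pi / 2"
        using tj[of j] by linarith
      then show ?thesis using s by (simp add: abs_mult)
    qed
    have "kuramoto_potential \<gamma> w (\<theta> + t *\<^sub>R axis k s) \<le> kuramoto_potential \<gamma> w \<theta>"
    proof (rule max)
      fix i j
      show "\<bar>(\<theta> + t *\<^sub>R axis k s) $ i - (\<theta> + t *\<^sub>R axis k s) $ j\<bar> \<le> pi / 2"
        using le[of i j] kj[of i] kj[of j] by (auto simp: axis_def abs_minus_commute)
    qed
    with d(2)[OF t(1,2)] show False by simp
  qed
  have strict: "\<theta> $ i - \<theta> $ k < pi / 2" for i k
  proof (rule ccontr)
    assume "\<not> \<theta> $ i - \<theta> $ k < pi / 2"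
    then have ik: "\<theta> $ i - \<theta> $ k = pi / 2"
      using le'[of i k] by simp
    \<comment> \<open>At distance \<open>pi / 2\<close>, \<open>i\<close> is topmost and
      \<open>k\<close> bottommost, so moving either one inward meets no constraint.\<close>
    have "- 1 * g i \<le> 0"
    proof (rule push)
      show "- 1 * (\<theta> $ i - \<theta> $ j) < pi / 2" for j
        unfolding mult_minus1 using le'[of j k] ik pi_gt_zero by linarith
    qed simp
    moreover have "1 * g k \<le> 0"
    proof (rule push)
      show "1 * (\<theta> $ k - \<theta> $ j) < pi / 2" for j
        unfolding mult_1 using le'[of i j] ik pi_gt_zero by linarith
    qed simp
    moreover have "\<gamma> * (coupling \<theta> $ i - coupling \<theta> $ k) \<le> \<gamma> * - real CARD('n)"
      using \<gamma> coupling_diff_extremes[OF le ik] by (intro mult_left_mono) auto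
    ultimately show False
      using spread[of i k] by (simp add: g_def algebra_simps)
  qed
  \<comment> \<open>With all differences strictly below \<open>pi / 2\<close>, every phase can move
    both ways, so the slope is bounded by 0 from both sides.\<close>
  have "g k = 0" for k
    using push[of 1 k] push[of "- 1" k] strict by fastforce
  then have "\<gamma> *\<^sub>R coupling \<theta> = - w"
    by (simp add: vec_eq_iff g_def eq_neg_iff_add_eq_0)
  moreover have "\<bar>\<theta> $ i - \<theta> $ j\<bar> < pi / 2" for i j
    using strict[of i j] strict[of j i] by linarith
  ultimately show ?thesis by (rule that)
qed

text \<open>Passing to the co-rotating frame preserves frequency differences and makes the
  frequencies sum to 0, as the shift argument requires.\<close>

lemma small_frequency_spread_imp_synchronous:
  fixes \<omega> :: "real ^ 'n"
  assumes "\<gamma> > 0" and "\<And>i k. \<omega> $ i - \<omega> $ k < \<gamma> * real CARD('n)"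
  shows "has_fully_synchronous_solution \<gamma> \<omega>"
proof -
  have "(\<Sum>i\<in>UNIV. corotating \<omega> $ i) = 0"
    by (simp add: corotating_def sum_subtractf)
  moreover have "corotating \<omega> $ i - corotating \<omega> $ k < \<gamma> * real CARD('n)" for i k
    using assms(2)[of i k] by (simp add: corotating_def)
  ultimately obtain \<theta> where "\<gamma> *\<^sub>R coupling \<theta> = - corotating \<omega>"
    and "\<And>i j. \<bar>\<theta> $ i - \<theta> $ j\<bar> < pi / 2"
    using equilibrium_in_quarter_arc[OF assms(1)] by metis
  then show ?thesis
    unfolding has_fully_synchronous_solution_iff using small_spread_stable by blast
qed

section \<open>Measurability of the set of synchronizing frequencies\<close>

lemma continuous_on_coupling [continuous_intros]: "continuous_on S coupling"
  unfolding coupling_def by (intro continuous_intros)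

lemma continuous_on_corotating [continuous_intros]: "continuous_on S corotating"
  unfolding corotating_def by (intro continuous_intros) auto

lemma continuous_on_cos_laplacian [continuous_intros]:
  fixes f g :: "'a::t2_space \<Rightarrow> real ^ 'n"
  shows "continuous_on S f \<Longrightarrow> continuous_on S g \<Longrightarrow> continuous_on S (\<lambda>z. cos_laplacian (f z) (g z))"
  unfolding cos_laplacian_def by (intro continuous_intros)

text \<open>By compactness of the unit sphere, injectivity on the hyperplane means a positive lower
  bound. For fixed \<open>n\<close> this bound is a closed condition on \<open>\<theta>\<close>, so
  triviality of the kernel becomes a countable union of closed conditions.\<close>

lemma trivial_ker_cos_laplacian_iff:
  fixes \<theta> :: "real ^ 'n"
  shows "(\<forall>x. cos_laplacian \<theta> x = 0 \<and> (\<Sum>i\<in>UNIV. x $ i) = 0 \<longrightarrow> x = 0) \<longleftrightarrow>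
    (\<exists>n. \<forall>x. norm x = 1 \<and> (\<Sum>i\<in>UNIV. x $ i) = 0 \<longrightarrow> 1 / real (Suc n) \<le> norm (cos_laplacian \<theta> x))"
    (is "?L \<longleftrightarrow> ?R")
proof
  assume inj: ?L
  \<comment> \<open>The unit sphere of the zero-sum hyperplane. It is empty for a single oscillator,
    hence the case distinction.\<close>
  define C where "C = {x :: real ^ 'n. norm x = 1 \<and> (\<Sum>i\<in>UNIV. x $ i) = 0}"
  show ?R
  proof (cases "C = {}")
    case False
    have "closed C"
      unfolding C_def by (intro closed_Collect_conj closed_Collect_eq continuous_intros)
    moreover have "bounded C"
      by (rule boundedI[of _ 1]) (simp add: C_def)
    ultimately have "compact C"
      by (simp add: compact_eq_bounded_closed)
    moreover have "continuous_on C (\<lambda>x. norm (cos_laplacian \<theta> x))"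
      by (intro continuous_intros)
    ultimately obtain y where y: "y \<in> C" "\<And>x. x \<in> C \<Longrightarrow> norm (cos_laplacian \<theta> y) \<le> norm (cos_laplacian \<theta> x)"
      using False by (metis continuous_attains_inf)
    have "cos_laplacian \<theta> y \<noteq> 0"
      using inj y(1) by (auto simp: C_def)
    then obtain n where "inverse (real (Suc n)) < norm (cos_laplacian \<theta> y)"
      using reals_Archimedean zero_less_norm_iff by blast
    then show ?thesis
      using y(2) by (intro exI[of _ n]) (force simp: C_def inverse_eq_divide)
  qed (auto simp: C_def)
next
  assume ?R
  then obtain n where n: "\<And>x. norm x = 1 \<Longrightarrow> (\<Sum>i\<in>UNIV. x $ i) = 0 \<Longrightarrow>
      1 / real (Suc n) \<le> norm (cos_laplacian \<theta> x)"
    by blast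
  show ?L
  proof (intro allI impI, rule ccontr)
    fix x assume x: "cos_laplacian \<theta> x = 0 \<and> (\<Sum>i\<in>UNIV. x $ i) = 0" and "x \<noteq> 0"
    define y where "y = (1 / norm x) *\<^sub>R x"
    have "1 / real (Suc n) \<le> norm (cos_laplacian \<theta> y)"
    proof (rule n)
      show "norm y = 1" using \<open>x \<noteq> 0\<close> by (simp add: y_def)
      show "(\<Sum>i\<in>UNIV. y $ i) = 0" using x by (simp add: y_def sum_divide_distrib[symmetric])
    qed
    moreover have "cos_laplacian \<theta> y = 0"
      using x by (simp add: y_def linear_scale[OF linear_cos_laplacian])
    ultimately show False by simp
  qed
qed

text \<open>The set is the preimage of the image of a \<open>\<sigma>\<close>-compact set of stable configurations; the
  quantitative bound \<open>1 / Suc n\<close> makes the pieces closed.\<close>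

lemma borel_synchronous_frequencies:
  "{\<omega> :: real ^ 'n. has_fully_synchronous_solution \<gamma> \<omega>} \<in> sets borel"
proof -
  define S where "S n m = {\<theta> :: real ^ 'n. (\<forall>x. x \<bullet> cos_laplacian \<theta> x \<le> 0) \<and>
      (\<forall>x. norm x = 1 \<and> (\<Sum>i\<in>UNIV. x $ i) = 0 \<longrightarrow> 1 / real (Suc n) \<le> norm (cos_laplacian \<theta> x)) \<and>
      norm \<theta> \<le> real m}" for n m :: nat
  have "closed (S n m)" for n m
    unfolding S_def
    by (intro closed_Collect_conj closed_Collect_all closed_Collect_imp closed_Collect_le open_Collect_const continuous_intros)
  \<comment> \<open>The norm bound \<open>m\<close> supplies compactness, so that the continuous
    image is closed; closedness of \<open>S n m\<close> alone would not give this.\<close>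
  moreover have "bounded (S n m)" for n m
    by (rule boundedI[of _ "real m"]) (simp add: S_def)
  ultimately have "compact (S n m)" for n m
    by (simp add: compact_eq_bounded_closed)
  then have "closed ((\<lambda>\<theta>. - (\<gamma> *\<^sub>R coupling \<theta>)) ` S n m)" for n m
    by (intro compact_imp_closed compact_continuous_image continuous_intros)
  then have "closed (corotating -` ((\<lambda>\<theta>. - (\<gamma> *\<^sub>R coupling \<theta>)) ` S n m))" for n m
    by (intro closed_vimage continuous_intros)
  moreover have "{\<omega>. has_fully_synchronous_solution \<gamma> \<omega>} =
      (\<Union>n m. corotating -` ((\<lambda>\<theta>. - (\<gamma> *\<^sub>R coupling \<theta>)) ` S n m))" (is "?A = ?B")
  proof (intro set_eqI iffI)
    fix \<omega> assume "\<omega> \<in> ?A"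
    then obtain \<theta> n where eq: "\<gamma> *\<^sub>R coupling \<theta> = - corotating \<omega>"
      and stable: "\<forall>x. x \<bullet> cos_laplacian \<theta> x \<le> 0"
        "\<forall>x. norm x = 1 \<and> (\<Sum>i\<in>UNIV. x $ i) = 0 \<longrightarrow> 1 / real (Suc n) \<le> norm (cos_laplacian \<theta> x)"
      unfolding has_fully_synchronous_solution_iff trivial_ker_cos_laplacian_iff mem_Collect_eq
      by metis
    obtain m where "norm \<theta> \<le> real m"
      using real_arch_simple by blast
    with stable have "\<theta> \<in> S n m"
      unfolding S_def by blast
    moreover have "corotating \<omega> = - (\<gamma> *\<^sub>R coupling \<theta>)"
      unfolding eq minus_minus ..
    ultimately show "\<omega> \<in> ?B"
      by blast
  next
    fix \<omega> assume "\<omega> \<in> ?B"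
    then obtain n m \<theta> where \<theta>: "\<theta> \<in> S n m" and eq: "corotating \<omega> = - (\<gamma> *\<^sub>R coupling \<theta>)"
      by blast
    have "\<gamma> *\<^sub>R coupling \<theta> = - corotating \<omega>"
      unfolding eq minus_minus ..
    then show "\<omega> \<in> ?A"
      using \<theta> unfolding S_def has_fully_synchronous_solution_iff trivial_ker_cos_laplacian_iff mem_Collect_eq
      by blast
  qed
  ultimately show ?thesis
    by auto
qed

section \<open>The error function and the standard normal distribution\<close>

lemma erf_has_real_derivative: "(erf has_real_derivative 2 / sqrt pi * exp (- x\<^sup>2)) (at x)"
proof -
  \<comment> \<open>The fundamental theorem is applied on a bounded interval; this choice puts both
    0 and \<open>x\<close> in its interior, so the derivative there is two-sided.\<close>
  define c where "c = \<bar>x\<bar> + 1"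
  have "((\<lambda>u. LBINT t=ereal 0..ereal u. exp (- t\<^sup>2)) has_vector_derivative exp (- x\<^sup>2))
      (at x within {-c..c})"
    by (rule interval_integral_FTC2) (auto simp: c_def intro!: continuous_intros)
  then have "((\<lambda>u. LBINT t=ereal 0..ereal u. exp (- t\<^sup>2)) has_vector_derivative exp (- x\<^sup>2)) (at x)"
    by (subst (asm) at_within_interior) (auto simp: c_def)
  then have "((\<lambda>u. LBINT t=0..ereal u. exp (- t\<^sup>2)) has_real_derivative exp (- x\<^sup>2)) (at x)"
    by (simp add: has_real_derivative_iff_has_vector_derivative zero_ereal_def)
  then show ?thesis
    unfolding erf_def[abs_def] by (rule DERIV_cmult)
qed

lemma erf_0 [simp]: "erf 0 = 0"
  by (simp add: erf_def zero_ereal_def)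

text \<open>The sum \<open>erf x + erf (- x)\<close> has derivative 0, so it equals its value at
  0.\<close>

lemma erf_minus: "erf (- x) = - erf x"
proof -
  have "((\<lambda>x. erf x + erf (- x)) has_real_derivative 0) (at x)" for x
    by (rule derivative_eq_intros DERIV_chain2[OF erf_has_real_derivative] refl | simp)+
  then have "erf x + erf (- x) = erf 0 + erf (- 0)"
    using DERIV_isconst_all by blast
  then show ?thesis by simp
qed

lemma (in prob_space) std_normal_prob_symmetric_interval:
  assumes D: "distributed M lborel X (normal_density 0 1)" and a: "0 \<le> a"
  shows "prob (X -` {-a<..<a} \<inter> space M) = erf (a / sqrt 2)"
proof -
  have half: "sqrt 2 / 2 = 1 / sqrt 2"
    by (simp add: field_simps)
  \<comment> \<open>The antiderivative of the normal density that vanishes at 0, that is, the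
    distribution function minus 1/2.\<close>
  have deriv: "((\<lambda>x. erf (x / sqrt 2) / 2) has_real_derivative normal_density 0 1 x) (at x)" for x
    using half
    by (auto intro!: derivative_eq_intros DERIV_chain2[OF erf_has_real_derivative]
        simp: normal_density_def power_divide real_sqrt_mult field_simps)
  have X: "X \<in> measurable M lborel"
    using D by (rule distributed_measurable)
  have "prob (X -` {-a<..<a} \<inter> space M) = (\<integral>x. indicat_real {-a<..<a} (X x) \<partial>M)"
  proof -
    have "(\<integral>x. indicat_real {-a<..<a} (X x) \<partial>M) = (\<integral>x. indicat_real (X -` {-a<..<a} \<inter> space M) x \<partial>M)"
      by (intro Bochner_Integration.integral_cong) (auto simp: indicator_def)
    then show ?thesis using X by simp
  qed
  also have "\<dots> = (\<integral>x. normal_density 0 1 x * indicator {-a<..<a} x \<partial>lborel)"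
    by (rule distributed_integral[OF D, symmetric]) auto
  \<comment> \<open>For ordered endpoints the oriented integral is taken over the open interval,
    matching the event exactly.\<close>
  also have "\<dots> = (LBINT x=ereal (-a)..ereal a. normal_density 0 1 x)"
    using a by (simp add: interval_lebesgue_integral_def set_lebesgue_integral_def mult.commute)
  also have "\<dots> = erf (a / sqrt 2) / 2 - erf (- a / sqrt 2) / 2"
  proof (rule interval_integral_FTC_finite)
    show "continuous_on {min (- a) a..max (- a) a} (normal_density 0 1)"
      unfolding normal_density_def by (intro continuous_intros) auto
    show "((\<lambda>x. erf (x / sqrt 2) / 2) has_vector_derivative normal_density 0 1 x)
        (at x within {min (- a) a..max (- a) a})" for x
      using deriv[of x] unfolding has_real_derivative_iff_has_vector_derivative
      by (rule has_vector_derivative_at_within)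
  qed
  finally show ?thesis
    using erf_minus[of "a / sqrt 2"] by simp
qed

section \<open>The probability bound from independence\<close>

theorem lemma4p4:
  fixes M :: "'a measure" and \<omega> :: "'n::finite \<Rightarrow> 'a \<Rightarrow> real" and \<gamma> :: real
  assumes "prob_space M"
    and "\<gamma> > 0"
    and "prob_space.indep_vars M (\<lambda>_. borel) \<omega> UNIV"
    and "\<And>i. distributed M lborel (\<omega> i) (normal_density 0 1)"
  shows "measure M {x \<in> space M. has_fully_synchronous_solution \<gamma> (\<chi> i. \<omega> i x)}
           \<ge> erf (\<gamma> * real CARD('n) / (2 * sqrt 2)) ^ CARD('n)"
proof -
  interpret prob_space M by fact
  \<comment> \<open>Two frequencies in the open interval from \<open>- a\<close> to \<open>a\<close>
    differ by less than \<open>2 * a\<close>, the spread allowed above; \<open>a / sqrt 2\<close> is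
    the argument of \<open>erf\<close> in the bound.\<close>
  define a where "a = \<gamma> * real CARD('n) / 2"
  have "a \<ge> 0"
    using assms(2) by (simp add: a_def)
  have \<omega>: "\<omega> i \<in> borel_measurable M" for i
    using distributed_measurable[OF assms(4)] by simp
  have "(\<lambda>x. \<chi> i. \<omega> i x) \<in> borel_measurable M"
  proof (rule borel_measurable_euclidean_space[THEN iffD2], rule ballI)
    fix b :: "real ^ 'n" assume "b \<in> Basis"
    then obtain i where "b = axis i 1"
      unfolding Basis_vec_def by auto
    then show "(\<lambda>x. (\<chi> i. \<omega> i x) \<bullet> b) \<in> borel_measurable M"
      using \<omega>[of i] by (simp add: inner_axis)
  qed
  \<comment> \<open>A set outside \<open>sets M\<close> would get measure 0 by convention, so
    monotonicity of the measure needs the synchronization event to be measurable.\<close>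
  from measurable_sets[OF this borel_synchronous_frequencies[of \<gamma>]]
  have meas: "{x \<in> space M. has_fully_synchronous_solution \<gamma> (\<chi> i. \<omega> i x)} \<in> sets M"
    by (simp add: vimage_def Int_def conj_commute)
  have "erf (\<gamma> * real CARD('n) / (2 * sqrt 2)) ^ CARD('n) =
      (\<Prod>i\<in>UNIV. prob (\<omega> i -` {-a<..<a} \<inter> space M))"
    using std_normal_prob_symmetric_interval[OF assms(4) \<open>a \<ge> 0\<close>] by (simp add: a_def)
  also have "\<dots> = prob (\<Inter>i\<in>UNIV. \<omega> i -` {-a<..<a} \<inter> space M)"
    by (rule indep_varsD[OF assms(3), symmetric]) auto
  also have "\<dots> \<le> prob {x \<in> space M. has_fully_synchronous_solution \<gamma> (\<chi> i. \<omega> i x)}"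
  proof (rule finite_measure_mono[OF _ meas], rule subsetI)
    fix x assume x: "x \<in> (\<Inter>i\<in>UNIV. \<omega> i -` {-a<..<a} \<inter> space M)"
    have "has_fully_synchronous_solution \<gamma> (\<chi> i. \<omega> i x)"
    proof (rule small_frequency_spread_imp_synchronous[OF assms(2)])
      fix i k
      have "\<omega> i x < a" "- a < \<omega> k x"
        using x by auto
      then show "(\<chi> i. \<omega> i x) $ i - (\<chi> i. \<omega> i x) $ k < \<gamma> * real CARD('n)"
        by (simp add: a_def)
    qed
    then show "x \<in> {x \<in> space M. has_fully_synchronous_solution \<gamma> (\<chi> i. \<omega> i x)}"
      using x by auto
  qed
  finally show ?thesis .
qed

end
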